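(* Let $\Delta$ be a $(d-1)$-dimensional Eulerian manifold with boundary $\partial\Delta$. The Dehn-Sommerville relations $$h_k(\Delta)-h_{d-k}(\Delta)= \binom{d}{k}(-1)^{d-k}\chi(\Delta)+h_k(\partial\Delta)-h_{k-1}(\partial\Delta)\quad\text{for all } 0\le k\le d$$ (where $\chi$ is the reduced Euler characteristic) are equivalent to the following condition on the $e$-vector: $$e_k(\Delta)=(-1)^{d-k} f_{k-1}(\Delta)+e_k(\partial\Delta)\quad\text{for all } 1\leq k\leq d.$$
   Context: Simplicial complexes are finite abstract simplicial complexes, and the empty face is counted as a face. For a $(D-1)$-dimensional simplicial complex $\Gamma$, let $f_i(\Gamma)$ be the number of $i$-dimensional faces, with $f_{-1}(\Gamma)=1$ (the empty face). The $e$-vector $(e_0(\Gamma),\dots,e_D(\Gamma))$ is the vector of coefficients of $\sum_{i=0}^D f_{i-1}(\Gamma)(t-1)^i=\sum_{k=0}^D e_k(\Gamma) t^k$, i.e. $e_k(\Gamma)=\sum_{i=k}^D(-1)^{i-k}\binom{i}{k}f_{i-1}(\Gamma)$. The $h$-vector $(h_0(\Gamma),\dots,h_D(\Gamma))$ is given by $h_k(\Gamma)=\sum_{i=0}^k(-1)^{k-i}\binom{D-i}{k-i}f_{i-1}(\Gamma)$. Entries with index outside $\{0,\dots,D\}$ are $0$. (For $\Delta$, $D=d$; for $\partial\Delta$, $D=d-1$, so $h_{-1}(\partial\Delta)=h_d(\partial\Delta)=e_d(\partial\Delta)=0$.) The ordinary Euler characteristic ignoring the empty face is $\tilde\chi(\Gamma)=\sum_{i\ge0}(-1)^if_i(\Gamma)$,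 and the reduced Euler characteristic is $\chi(\Gamma)=\tilde\chi(\Gamma)-1=\sum_{i\ge -1}(-1)^if_i(\Gamma)$. The link of $\sigma\in\Delta$ is $\mathrm{Lk}\,\sigma=\{\tau\in\Delta\mid \sigma\cup\tau\in\Delta,\ \sigma\cap\tau=\emptyset\}$. A complex is pure if all its maximal faces have the same dimension. A pure $(D-1)$-dimensional simplicial complex $\Gamma$ is a $(D-1)$-dimensional Eulerian manifold if $\tilde\chi(\mathrm{Lk}\,\sigma)=1+(-1)^{D-\dim\sigma}$ for every nonempty $\sigma\in\Gamma$ (links in $\Gamma$). A pure $(d-1)$-dimensional simplicial complex $\Delta$ is an Eulerian manifold with boundary $\partial\Delta$ if: (i) $\partial\Delta$ is a subcomplex of $\Delta$ and is itself a $(d-2)$-dimensional Eulerian manifold; (ii) every simplex $\sigma\in\Delta$ not contained in $\partial\Delta$ satisfies $\tilde\chi(\mathrm{Lk}\,\sigma)=1+(-1)^{d+\dim\sigma}$; (iii) every nonempty simplex $\sigma\in\partial\Delta$ satisfies $\tilde\chi(\mathrm{Lk}\,\sigma)=1$, where the link is taken in all of $\Delta$. *)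

theory Defs
  imports Main "HOL-Computational_Algebra.Polynomial"
begin

text \<open>
  Dimensions and indices are integers: the empty face has dimension \<open>-1\<close>, and the
  vectors below are \<open>0\<close> outside their index range.
\<close>

definition simplicial_complex :: "'a set set \<Rightarrow> bool" where
  "simplicial_complex \<Gamma> \<longleftrightarrow>
     finite \<Gamma> \<and> (\<forall>\<sigma>\<in>\<Gamma>. finite \<sigma>) \<and> {} \<in> \<Gamma> \<and> (\<forall>\<sigma>\<in>\<Gamma>. \<forall>\<tau>. \<tau> \<subseteq> \<sigma> \<longrightarrow> \<tau> \<in> \<Gamma>)"

definition face_dim :: "'a set \<Rightarrow> int" where
  "face_dim \<sigma> = int (card \<sigma>) - 1"

definition complex_dim :: "'a set set \<Rightarrow> int" where
  "complex_dim \<Gamma> = Max (face_dim ` \<Gamma>)"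

definition maximal_face :: "'a set set \<Rightarrow> 'a set \<Rightarrow> bool" where
  "maximal_face \<Gamma> \<sigma> \<longleftrightarrow> \<sigma> \<in> \<Gamma> \<and> (\<forall>\<tau>\<in>\<Gamma>. \<sigma> \<subseteq> \<tau> \<longrightarrow> \<tau> = \<sigma>)"

definition pure_complex :: "'a set set \<Rightarrow> bool" where
  "pure_complex \<Gamma> \<longleftrightarrow>
     (\<forall>\<sigma> \<tau>. maximal_face \<Gamma> \<sigma> \<and> maximal_face \<Gamma> \<tau> \<longrightarrow> face_dim \<sigma> = face_dim \<tau>)"

definition link :: "'a set set \<Rightarrow> 'a set \<Rightarrow> 'a set set" where
  "link \<Delta> \<sigma> = {\<tau> \<in> \<Delta>. \<sigma> \<union> \<tau> \<in> \<Delta> \<and> \<sigma> \<inter> \<tau> = {}}"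

definition f_vec :: "'a set set \<Rightarrow> int \<Rightarrow> nat" where
  "f_vec \<Gamma> i = card {\<sigma> \<in> \<Gamma>. face_dim \<sigma> = i}"

text \<open>Euler characteristic ignoring the empty face, and the reduced one.\<close>

definition euler_char :: "'a set set \<Rightarrow> int" where
  "euler_char \<Gamma> = (\<Sum>i\<in>{0..complex_dim \<Gamma>}. (-1) ^ nat i * int (f_vec \<Gamma> i))"

definition reduced_euler_char :: "'a set set \<Rightarrow> int" where
  "reduced_euler_char \<Gamma> = euler_char \<Gamma> - 1"

text \<open>The number \<open>D\<close> such that \<open>\<Gamma>\<close> is \<open>(D - 1)\<close>-dimensional.\<close>

definition rank_of :: "'a set set \<Rightarrow> nat" where
  "rank_of \<Gamma> = nat (complex_dim \<Gamma> + 1)"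

definition e_poly :: "'a set set \<Rightarrow> int poly" where
  "e_poly \<Gamma> = (\<Sum>i\<le>rank_of \<Gamma>. smult (int (f_vec \<Gamma> (int i - 1))) ([:-1, 1:] ^ i))"

definition e_vec :: "'a set set \<Rightarrow> int \<Rightarrow> int" where
  "e_vec \<Gamma> k = (if k < 0 then 0 else coeff (e_poly \<Gamma>) (nat k))"

lemma e_vec_eq:
  "e_vec \<Gamma> (int k) =
     (\<Sum>i=k..rank_of \<Gamma>. (-1) ^ (i - k) * int (i choose k) * int (f_vec \<Gamma> (int i - 1)))"
proof -
  have c: "coeff ([:-1, 1:] ^ i) k = (if k \<le> i then (-1) ^ (i - k) * int (i choose k) else 0)" for i
  proof (cases "k \<le> i")
    case True
    then show ?thesis
      using coeff_linear_poly_power[of k i "-1::int" 1] by (simp add: mult.commute)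
  next
    case False
    have "degree ([:-1, 1::int:] ^ i) \<le> i"
      using degree_power_le[of "[:-1, 1::int:]" i] by simp
    with False show ?thesis by (simp add: coeff_eq_0)
  qed
  have "e_vec \<Gamma> (int k) =
      (\<Sum>i\<le>rank_of \<Gamma>. int (f_vec \<Gamma> (int i - 1)) * coeff ([:-1, 1:] ^ i) k)"
    by (simp add: e_vec_def e_poly_def coeff_sum)
  also have "\<dots> = (\<Sum>i\<in>{k..rank_of \<Gamma>}. int (f_vec \<Gamma> (int i - 1)) * coeff ([:-1, 1:] ^ i) k)"
    by (rule sum.mono_neutral_right) (auto simp: c)
  also have "\<dots> = (\<Sum>i=k..rank_of \<Gamma>. (-1) ^ (i - k) * int (i choose k) * int (f_vec \<Gamma> (int i - 1)))"
    by (rule sum.cong) (auto simp: c)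
  finally show ?thesis .
qed

definition h_vec :: "'a set set \<Rightarrow> int \<Rightarrow> int" where
  "h_vec \<Gamma> k =
     (if k < 0 \<or> k > int (rank_of \<Gamma>) then 0
      else \<Sum>i=0..nat k. (-1) ^ (nat k - i) * int ((rank_of \<Gamma> - i) choose (nat k - i))
                          * int (f_vec \<Gamma> (int i - 1)))"

text \<open>
  In both definitions \<open>n\<close> is the dimension of the complex, so \<open>n + 1\<close> is the \<open>D\<close> (or \<open>d\<close>)
  in the usual formulas \<open>1 + (-1)^(D - dim \<sigma>)\<close> and \<open>1 + (-1)^(d + dim \<sigma>)\<close>. The exponents
  are nonnegative for all faces concerned, so \<open>nat\<close> never truncates. Since a simplicial
  complex contains the empty face, a complex with boundary has \<open>n \<ge> 0\<close>.
\<close>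

definition eulerian_manifold :: "int \<Rightarrow> 'a set set \<Rightarrow> bool" where
  "eulerian_manifold n \<Gamma> \<longleftrightarrow>
     simplicial_complex \<Gamma> \<and> pure_complex \<Gamma> \<and> complex_dim \<Gamma> = n \<and>
     (\<forall>\<sigma>\<in>\<Gamma>. \<sigma> \<noteq> {} \<longrightarrow> euler_char (link \<Gamma> \<sigma>) = 1 + (-1) ^ nat (n + 1 - face_dim \<sigma>))"

definition eulerian_manifold_with_boundary :: "int \<Rightarrow> 'a set set \<Rightarrow> 'a set set \<Rightarrow> bool" where
  "eulerian_manifold_with_boundary n \<Delta> B \<longleftrightarrow>
     simplicial_complex \<Delta> \<and> pure_complex \<Delta> \<and> complex_dim \<Delta> = n \<and>
     B \<subseteq> \<Delta> \<and> eulerian_manifold (n - 1) B \<and>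
     (\<forall>\<sigma>\<in>\<Delta>. \<sigma> \<notin> B \<longrightarrow> euler_char (link \<Delta> \<sigma>) = 1 + (-1) ^ nat (n + 1 + face_dim \<sigma>)) \<and>
     (\<forall>\<sigma>\<in>B. \<sigma> \<noteq> {} \<longrightarrow> euler_char (link \<Delta> \<sigma>) = 1)"

end

theory Submission
  imports Defs
begin

text \<open>
  The equivalence is a change of variables in the generating function of the face numbers.
  Let \<open>F(x, y) = (\<Sum>i\<le>d. f\<^bsub>i-1\<^esub>(\<Delta>) x\<^sup>i y\<^bsup>d-i\<^esup>)\<close>, and let \<open>F'\<close> be the form of the same degree
  \<open>d\<close> for the boundary. The forms with coefficients \<open>h\<^sub>k(\<Delta>)\<close> and \<open>e\<^sub>k(\<Delta>)\<close> are
  \<open>F(x, y - x)\<close> and \<open>F(x - y, y)\<close> (lemmas \<open>h_vec_form\<close> and \<open>e_vec_form\<close>).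

  In the relations for \<open>h\<close>, replacing \<open>h\<^sub>k\<close> by \<open>h\<^bsub>d-k\<^esub>\<close> exchanges \<open>x\<close> and \<open>y\<close>. The
  \<open>h\<close>-form of the boundary has degree \<open>d - 1\<close> only; the factor \<open>y - x\<close> that turns it into
  \<open>F'(x, y - x)\<close> also turns its coefficients into the differences
  \<open>h\<^sub>k(\<partial>\<Delta>) - h\<^bsub>k-1\<^esub>(\<partial>\<Delta>)\<close>. With \<open>y = x + z\<close> the relations become the identity
  \<open>F(x, z) - F(x + z, -z) = \<chi>(\<Delta>) (-z)\<^sup>d + F'(x, z)\<close>.

  In the relations for \<open>e\<close>, the term \<open>(-1)\<^bsup>d-k\<^esup> f\<^bsub>k-1\<^esub>(\<Delta>)\<close> contributes the form \<open>F(x, -y)\<close>.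
  With \<open>x + z\<close> for \<open>x\<close> and \<open>z\<close> for \<open>y\<close> they say that the two sides of the same identity,
  as forms in \<open>x + z\<close> and \<open>z\<close>, agree in all coefficients except perhaps the one for \<open>k = 0\<close>,
  to which \<open>\<chi>(\<Delta>) (-z)\<^sup>d\<close> belongs. This last coefficient agrees too: the sum of all
  coefficients is the value at \<open>x = 0\<close>, \<open>z = 1\<close>, where the identity reads
  \<open>1 - F(1, -1) = (-1)\<^sup>d \<chi>(\<Delta>) + 1\<close> and holds by the definition of \<open>\<chi>\<close>, because each complex
  has exactly one empty face.
\<close>

text \<open>
  Forms in two variables make the reversal of the \<open>h\<close>-vector and the passage between \<open>h\<close> and
  \<open>e\<close> substitutions over the integers; one variable would require rational functions. Nothing
  is lost: a form is determined by its values on the line \<open>y = 1\<close>, where it is an ordinary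
  polynomial.
\<close>

lemma homogeneous_form_eq_iff:
  fixes a b :: "nat \<Rightarrow> int"
  shows "(\<forall>k\<le>n. a k = b k) \<longleftrightarrow>
    (\<forall>x y. (\<Sum>k\<le>n. a k * x ^ k * y ^ (n - k)) = (\<Sum>k\<le>n. b k * x ^ k * y ^ (n - k)))"
proof
  assume "\<forall>x y. (\<Sum>k\<le>n. a k * x ^ k * y ^ (n - k)) = (\<Sum>k\<le>n. b k * x ^ k * y ^ (n - k))"
  then have "(\<Sum>k\<le>n. a k * x ^ k) = (\<Sum>k\<le>n. b k * x ^ k)" for x
    by (metis (no_types, lifting) mult.right_neutral power_one sum.cong)
  then have "poly (\<Sum>k\<le>n. monom (a k) k) = poly (\<Sum>k\<le>n. monom (b k) k)"
    by (simp add: fun_eq_iff poly_sum poly_monom)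
  then have "coeff (\<Sum>k\<le>n. monom (a k) k) j = coeff (\<Sum>k\<le>n. monom (b k) k) j" for j
    by (simp only: poly_eq_poly_eq_iff)
  then have "(if j \<le> n then a j else 0) = (if j \<le> n then b j else 0)" for j
    by (simp add: coeff_sum)
  then show "\<forall>k\<le>n. a k = b k"
    by metis
qed simp

lemma f_vec_above_dim:
  assumes "finite \<Gamma>" and "complex_dim \<Gamma> < i"
  shows "f_vec \<Gamma> i = 0"
proof -
  have "face_dim \<sigma> \<le> complex_dim \<Gamma>" if "\<sigma> \<in> \<Gamma>" for \<sigma>
    unfolding complex_dim_def using assms(1) that by simp
  with assms(2) have "{\<sigma> \<in> \<Gamma>. face_dim \<sigma> = i} = {}"
    by force
  then show ?thesis
    unfolding f_vec_def by (simp only: card.empty)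
qed

lemma f_vec_empty_face:
  assumes "simplicial_complex \<Gamma>"
  shows "f_vec \<Gamma> (- 1) = 1"
proof -
  have "{\<sigma> \<in> \<Gamma>. face_dim \<sigma> = - 1} = {{}}"
    using assms by (auto simp: simplicial_complex_def face_dim_def)
  then show ?thesis
    by (simp add: f_vec_def)
qed

text \<open>
  The degree \<open>n\<close> is independent of the dimension of the complex, because the boundary has to be
  compared with a complex of dimension one higher.
\<close>

definition face_form :: "nat \<Rightarrow> 'a set set \<Rightarrow> int \<Rightarrow> int \<Rightarrow> int" where
  "face_form n \<Gamma> x y = (\<Sum>i\<le>n. int (f_vec \<Gamma> (int i - 1)) * x ^ i * y ^ (n - i))"

lemma face_form_Suc:
  assumes "finite \<Gamma>" and "complex_dim \<Gamma> < int n"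
  shows "face_form (Suc n) \<Gamma> x y = y * face_form n \<Gamma> x y"
  using f_vec_above_dim[OF assms]
  by (simp add: face_form_def sum_distrib_left Suc_diff_le mult_ac cong: sum.cong_simp)

lemma face_form_0_1:
  assumes "simplicial_complex \<Gamma>"
  shows "face_form n \<Gamma> 0 1 = 1"
  using f_vec_empty_face[OF assms] by (simp add: face_form_def power_0_left
      if_distrib[of "\<lambda>t. _ * t"] cong: if_cong)

lemma reduced_euler_char_eq_face_form:
  assumes "simplicial_complex \<Gamma>" and "complex_dim \<Gamma> = int n - 1"
  shows "reduced_euler_char \<Gamma> * (- 1) ^ n = - face_form n \<Gamma> 1 (- 1)"
proof -
  have "euler_char \<Gamma> = (\<Sum>i<n. (- 1) ^ i * int (f_vec \<Gamma> (int i)))"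
    unfolding euler_char_def assms(2)
    by (rule sum.reindex_bij_witness[of _ int nat]) auto
  also have "\<dots> = - (\<Sum>i\<in>{1..n}. (- 1) ^ i * int (f_vec \<Gamma> (int i - 1)))"
    unfolding sum_negf[symmetric]
    by (rule sum.reindex_bij_witness[of _ "\<lambda>i. i - 1" Suc]) auto
  finally have "reduced_euler_char \<Gamma> = - (\<Sum>i\<le>n. (- 1) ^ i * int (f_vec \<Gamma> (int i - 1)))"
    using f_vec_empty_face[OF assms(1)]
    by (simp add: reduced_euler_char_def atMost_atLeast0 sum.atLeast_Suc_atMost)
  moreover have "(- 1) ^ (n - i) = (- 1) ^ n * (- 1 :: int) ^ i" if "i \<le> n" for i
    using that by (simp add: minus_one_power_iff)
  ultimately show ?thesis
    by (simp add: face_form_def sum_distrib_left mult_ac)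
qed

lemma e_vec_form:
  assumes "finite \<Gamma>" and "complex_dim \<Gamma> < int n"
  shows "(\<Sum>k\<le>n. e_vec \<Gamma> (int k) * x ^ k * y ^ (n - k)) = face_form n \<Gamma> (x - y) y"
proof -
  let ?f = "\<lambda>i. int (f_vec \<Gamma> (int i - 1))"
  have e: "e_vec \<Gamma> (int k) = (\<Sum>i=k..n. (- 1) ^ (i - k) * int (i choose k) * ?f i)" for k
    unfolding e_vec_eq using assms f_vec_above_dim[OF assms(1)]
    by (intro sum.mono_neutral_left) (auto simp: rank_of_def)
  have "(\<Sum>k\<le>n. e_vec \<Gamma> (int k) * x ^ k * y ^ (n - k)) =
      (\<Sum>k\<le>n. \<Sum>i=k..n. (- 1) ^ (i - k) * int (i choose k) * ?f i * x ^ k * y ^ (n - k))"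
    by (simp add: e sum_distrib_right)
  also have "\<dots> =
      (\<Sum>i\<le>n. \<Sum>k\<le>i. (- 1) ^ (i - k) * int (i choose k) * ?f i * x ^ k * y ^ (n - k))"
    unfolding sum.Sigma[OF finite_atMost ballI[OF finite_atLeastAtMost]]
      sum.Sigma[OF finite_atMost ballI[OF finite_atMost]]
    by (rule sum.reindex_bij_witness[of _ prod.swap prod.swap]) auto
  also have "\<dots> = (\<Sum>i\<le>n. ?f i * (x + - y) ^ i * y ^ (n - i))"
  proof (rule sum.cong[OF refl])
    fix i assume "i \<in> {..n}"
    have "(- 1) ^ (i - k) * int (i choose k) * ?f i * x ^ k * y ^ (n - k) =
        ?f i * (int (i choose k) * x ^ k * (- y) ^ (i - k)) * y ^ (n - i)" if "k \<le> i" for k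
    proof -
      have "y ^ (n - k) = y ^ (i - k) * y ^ (n - i)"
        using that \<open>i \<in> {..n}\<close> by (simp flip: power_add)
      then show ?thesis
        by (simp only: power_minus[of y] mult_ac)
    qed
    then show "(\<Sum>k\<le>i. (- 1) ^ (i - k) * int (i choose k) * ?f i * x ^ k * y ^ (n - k)) =
        ?f i * (x + - y) ^ i * y ^ (n - i)"
      unfolding binomial_ring sum_distrib_left sum_distrib_right
      by (intro sum.cong) auto
  qed
  finally show ?thesis
    by (simp add: face_form_def)
qed

lemma h_vec_form:
  assumes "rank_of \<Gamma> = n"
  shows "(\<Sum>k\<le>n. h_vec \<Gamma> (int k) * x ^ k * y ^ (n - k)) = face_form n \<Gamma> x (y - x)"
proof -
  let ?f = "\<lambda>i. int (f_vec \<Gamma> (int i - 1))"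
  have "(\<Sum>k\<le>n. h_vec \<Gamma> (int k) * x ^ k * y ^ (n - k)) =
      (\<Sum>k\<le>n. \<Sum>i\<le>k. (- 1) ^ (k - i) * int ((n - i) choose (k - i)) * ?f i * x ^ k * y ^ (n - k))"
    by (simp add: h_vec_def assms sum_distrib_right atLeast0AtMost)
  also have "\<dots> = (\<Sum>i\<le>n. \<Sum>j\<le>n - i.
      (- 1) ^ j * int ((n - i) choose j) * ?f i * x ^ (i + j) * y ^ (n - i - j))"
    unfolding sum.Sigma[OF finite_atMost ballI[OF finite_atMost]]
    by (rule sum.reindex_bij_witness[of _ "\<lambda>(i, j). (i + j, i)" "\<lambda>(k, i). (i, k - i)"]) auto
  also have "\<dots> = (\<Sum>i\<le>n. ?f i * x ^ i * (- x + y) ^ (n - i))"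
    unfolding binomial_ring sum_distrib_left
    by (intro sum.cong) (auto simp: power_minus[of x] power_add)
  finally show ?thesis
    by (simp add: face_form_def)
qed

text \<open>
  Multiplication of a form by \<open>y - x\<close> takes first differences of its coefficients. The last
  difference is complete because the \<open>h\<close>-vector vanishes above its index range.
\<close>

lemma h_vec_difference_form:
  assumes "rank_of \<Gamma> = n"
  shows "(\<Sum>k\<le>Suc n. (h_vec \<Gamma> (int k) - h_vec \<Gamma> (int k - 1)) * x ^ k * y ^ (Suc n - k)) =
    (y - x) * face_form n \<Gamma> x (y - x)"
proof -
  have "(\<Sum>k\<le>Suc n. h_vec \<Gamma> (int k) * x ^ k * y ^ (Suc n - k)) =
      y * (\<Sum>k\<le>n. h_vec \<Gamma> (int k) * x ^ k * y ^ (n - k))"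
    using assms by (simp add: h_vec_def[of _ "1 + int n"] sum_distrib_left Suc_diff_le mult_ac
      cong: sum.cong_simp)
  moreover have "(\<Sum>k\<le>Suc n. h_vec \<Gamma> (int k - 1) * x ^ k * y ^ (Suc n - k)) =
      x * (\<Sum>k\<le>n. h_vec \<Gamma> (int k) * x ^ k * y ^ (n - k))"
    unfolding sum.atMost_Suc_shift by (simp add: h_vec_def[of _ "- 1"] sum_distrib_left mult_ac)
  ultimately show ?thesis
    by (simp only: left_diff_distrib sum_subtractf h_vec_form[OF assms])
qed

text \<open>Reversing the coefficients of a form exchanges its variables.\<close>

lemma h_vec_reversed_form:
  assumes "rank_of \<Gamma> = n"
  shows "(\<Sum>k\<le>n. h_vec \<Gamma> (int n - int k) * x ^ k * y ^ (n - k)) = face_form n \<Gamma> y (x - y)"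
  unfolding h_vec_form[OF assms, symmetric]
  by (rule sum.reindex_bij_witness[of _ "\<lambda>k. n - k" "\<lambda>k. n - k"]) auto

theorem theorem8:
  fixes \<Delta> B :: "'a set set" and d :: nat
  assumes "eulerian_manifold_with_boundary (int d - 1) \<Delta> B"
  shows
    "(\<forall>k\<le>d. h_vec \<Delta> (int k) - h_vec \<Delta> (int d - int k)
               = int (d choose k) * (-1) ^ (d - k) * reduced_euler_char \<Delta>
                 + h_vec B (int k) - h_vec B (int k - 1))
     \<longleftrightarrow>
     (\<forall>k\<in>{1..d}. e_vec \<Delta> (int k) = (-1) ^ (d - k) * int (f_vec \<Delta> (int k - 1)) + e_vec B (int k))"
    (is "?H \<longleftrightarrow> ?E")
proof -
  let ?\<chi> = "reduced_euler_char \<Delta>"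
  let ?F = "face_form d \<Delta>" and ?F' = "face_form d B"
  have \<Delta>: "simplicial_complex \<Delta>" "complex_dim \<Delta> = int d - 1"
    and B: "simplicial_complex B" "complex_dim B = int d - 2"
    using assms by (auto simp: eulerian_manifold_with_boundary_def eulerian_manifold_def)
  have fin: "finite \<Delta>" "finite B"
    using \<Delta> B by (auto simp: simplicial_complex_def)
  \<comment> \<open>The empty face of the boundary has dimension \<open>-1 \<le> d - 2\<close>.\<close>
  have "d \<noteq> 0"
    using f_vec_above_dim[OF fin(2), of "- 1"] f_vec_empty_face[OF B(1)] B(2) by auto
  then obtain m where d: "d = Suc m"
    by (cases d) auto
  have rank: "rank_of \<Delta> = d" "rank_of B = m"
    using \<Delta> B d by (auto simp: rank_of_def)
  have F': "?F' x z = z * face_form m B x z" for x z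
    unfolding d using B d fin by (intro face_form_Suc) auto
  have \<chi>: "?\<chi> * (- 1) ^ d = - ?F 1 (- 1)"
    using \<Delta> by (rule reduced_euler_char_eq_face_form)

  \<comment> \<open>Both systems of relations say that this holds for all \<open>x\<close> and \<open>z\<close>.\<close>
  define relation where
    "relation x z \<longleftrightarrow> ?F x z - ?F (x + z) (- z) = ?\<chi> * (- z) ^ d + ?F' x z" for x z

  have "?H \<longleftrightarrow> (\<forall>x y. relation x (y - x))"
  proof -
    have lhs: "(\<Sum>k\<le>d. (h_vec \<Delta> (int k) - h_vec \<Delta> (int d - int k)) * x ^ k * y ^ (d - k)) =
        ?F x (y - x) - ?F y (x - y)" for x y
      by (simp only: left_diff_distrib sum_subtractf h_vec_form[OF rank(1)]
        h_vec_reversed_form[OF rank(1)])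
    have binom: "(\<Sum>k\<le>d. int (d choose k) * (- 1) ^ (d - k) * ?\<chi> * x ^ k * y ^ (d - k)) =
        ?\<chi> * (x - y) ^ d" for x y
      using binomial_ring[of x "- y" d]
      by (simp add: sum_distrib_left power_minus[of y] mult_ac)
    have rhs: "(\<Sum>k\<le>d. (int (d choose k) * (- 1) ^ (d - k) * ?\<chi>
          + h_vec B (int k) - h_vec B (int k - 1)) * x ^ k * y ^ (d - k)) =
        ?\<chi> * (x - y) ^ d + ?F' x (y - x)" for x y
      using binom[of x y] h_vec_difference_form[OF rank(2), of x y]
      unfolding F' d[symmetric] by (simp only: add_diff_eq[symmetric] distrib_right sum.distrib)
    show ?thesis
      unfolding homogeneous_form_eq_iff lhs rhs relation_def by simp
  qed
  also have "\<dots> \<longleftrightarrow> (\<forall>x z. relation x z)"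
    by (metis add_diff_cancel_left')
  also have "\<dots> \<longleftrightarrow> (\<forall>x z. relation (x - z) z)"
    by (metis add_diff_cancel_right')
  also have "\<dots> \<longleftrightarrow> ?E"
  proof -
    \<comment> \<open>The correction at \<open>k = 0\<close> is the contribution of \<open>\<chi> (-z)\<^sup>d\<close>, which the relations
      for \<open>k \<ge> 1\<close> do not see.\<close>
    define D where "D k = e_vec \<Delta> (int k) - (- 1) ^ (d - k) * int (f_vec \<Delta> (int k - 1))
      - e_vec B (int k) - (if k = 0 then (- 1) ^ d * ?\<chi> else 0)" for k
    have signed: "(\<Sum>k\<le>d. (- 1) ^ (d - k) * int (f_vec \<Delta> (int k - 1)) * x ^ k * y ^ (d - k)) =
        ?F x (- y)" for x y
      by (simp add: face_form_def power_minus[of y] mult_ac)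
    have const: "(\<Sum>k\<le>d. (if k = 0 then c else 0) * x ^ k * y ^ (d - k)) = c * y ^ d"
      for c x y :: int
      by (simp add: if_distrib[of "\<lambda>t. t * _"] cong: if_cong)
    have D_form: "(\<Sum>k\<le>d. D k * x ^ k * y ^ (d - k)) =
        ?F (x - y) y - ?F x (- y) - ?F' (x - y) y - ?\<chi> * (- y) ^ d" for x y
    proof -
      have e: "(\<Sum>k\<le>d. e_vec \<Delta> (int k) * x ^ k * y ^ (d - k)) = ?F (x - y) y"
        "(\<Sum>k\<le>d. e_vec B (int k) * x ^ k * y ^ (d - k)) = ?F' (x - y) y"
        using \<Delta> B fin by (auto intro!: e_vec_form)
      show ?thesis
        unfolding D_def left_diff_distrib sum_subtractf e signed const
        by (simp add: power_minus[of y])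
    qed
    have "relation (x - z) z \<longleftrightarrow> (\<Sum>k\<le>d. D k * x ^ k * z ^ (d - k)) = 0" for x z
      unfolding D_form relation_def by auto
    then have "(\<forall>x z. relation (x - z) z) \<longleftrightarrow> (\<forall>k\<le>d. D k = 0)"
      using homogeneous_form_eq_iff[of d D "\<lambda>_. 0"] by simp
    also have "\<dots> \<longleftrightarrow> (\<forall>k\<in>{1..d}. D k = 0)"
    proof -
      \<comment> \<open>At \<open>x = y = 1\<close> the forms of \<open>\<Delta>\<close> and \<open>B\<close> at \<open>(0, 1)\<close> count one empty face each
        and cancel, as do the two terms that express \<open>\<chi>\<close>.\<close>
      have "(\<Sum>k\<le>d. D k) = 0"
        using D_form[of 1 1] \<chi> face_form_0_1[OF \<Delta>(1)] face_form_0_1[OF B(1)] by simp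
      then have "D 0 = - (\<Sum>k\<in>{1..d}. D k)"
        by (simp add: atMost_atLeast0 sum.atLeast_Suc_atMost)
      then have "D 0 = 0" if "\<forall>k\<in>{1..d}. D k = 0"
        using that by simp
      then show ?thesis
        by (metis One_nat_def Suc_leI atLeastAtMost_iff neq0_conv)
    qed
    also have "\<dots> \<longleftrightarrow> ?E"
      by (intro ball_cong) (auto simp: D_def)
    finally show ?thesis .
  qed
  finally show ?thesis .
qed

end
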